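(* The cyclic projection (CP), randomly permuted projection (RPP) and mean projection (MP) methods locally converge to a solution of the system of nonlinear equations $\boldsymbol f(\boldsymbol x)=\boldsymbol 0$, denoted $\boldsymbol x^*$, at a linear rate if $\mathrm{rank}(\boldsymbol U)=n$, where $$\boldsymbol U=\left[\frac{\nabla f_1(\boldsymbol x^* )}{\|\nabla f_1(\boldsymbol x^* )\|_2},\cdots,\frac{\nabla f_m(\boldsymbol x^* )}{\|\nabla f_m(\boldsymbol x^* )\|_2}\right]\in\mathbb{R}^{n\times m}.$$ Let $\{\boldsymbol x^k\}_{k=1,2,\cdots}$ be the sequence generated by the method. There exists a neighborhood centered at $\boldsymbol x^*$ with radius $\delta>0$, $$\mathcal B_\delta(\boldsymbol x^* )=\{\boldsymbol x : \|\boldsymbol x-\boldsymbol x^*\|_2<\delta\},$$ such that if the initial guess $\boldsymbol x^0\in\mathcal B_\delta(\boldsymbol x^* )$, then $$\|\boldsymbol x^k-\boldsymbol x^*\|_2<\gamma^k\|\boldsymbol x^0-\boldsymbol x^*\|_2,$$ where the convergence rate $$\gamma=\epsilon+\|\nabla\Phi(\boldsymbol x^* )\|_2$$ satisfies $0<\gamma<1$, since the spectral norm $\|\nabla\Phi(\boldsymbol x^* )\|_2<1$ and $\epsilon>0$ can be arbitrarily small as $\delta$ decreases. Here $\Phi$ is the iteration map of the method considered ($\Phi_{\mathrm{MP}}$, $\Phi_{\mathrm{CP}}$ or $\Phi_{\mathrm{RPP}}$).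
   Context: Let $\boldsymbol f=(f_1,\dots,f_m)^\top:\mathbb{R}^n\to\mathbb{R}^m$ with real-valued components $f_i$, let $\mathcal S_i=\{\boldsymbol x\in\mathbb{R}^n: f_i(\boldsymbol x)=0\}$ (not necessarily convex), and let $\boldsymbol x^*\in\cap_{i=1}^m\mathcal S_i$, i.e. $\boldsymbol f(\boldsymbol x^* )=\boldsymbol 0$. $\nabla f_i(\boldsymbol x^* )$ is the gradient of $f_i$ at $\boldsymbol x^*$, assumed nonzero for every $i$. $\Pi_i(\boldsymbol z)=\arg\min_{\boldsymbol x\in\mathcal S_i}\|\boldsymbol x-\boldsymbol z\|_2^2$ is the projection of $\boldsymbol z\in\mathbb{R}^n$ onto $\mathcal S_i$. Standing assumption: every $\Pi_i$, $i=1,\dots,m$, is differentiable at $\boldsymbol x^*$. Each method is written $\boldsymbol x^{k+1}=\Phi(\boldsymbol x^k)$, $k=0,1,\dots$, with iteration map $\Phi:\mathbb{R}^n\to\mathbb{R}^n$: - MP: $\Phi_{\mathrm{MP}}=\frac1m\sum_{i=1}^m\Pi_i$; - CP: $\Phi_{\mathrm{CP}}=\Pi_m\Pi_{m-1}\cdots\Pi_2\Pi_1$ (composition; one cycle of $m$ projections); - RPP: $\Phi_{\mathrm{RPP}}=\Pi_{i_m}\Pi_{i_{m-1}}\cdots\Pi_{i_2}\Pi_{i_1}$ (composition), where $\{i_1,\dots,i_m\}$ is a random permutation of $\{1,\dots,m\}$, the order being a random permutation at each cycle. Thus one step $k\mapsto k+1$ is one iteration for MP and one cycle of $m$ projections for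 CP and RPP. $\nabla\Phi(\boldsymbol x^* )\in\mathbb{R}^{n\times n}$ is the Jacobian matrix of $\Phi$ at $\boldsymbol x^*$, and $\|\cdot\|_2$ of a matrix is its spectral norm.
   Formalization: The strict error bound is stated for k ≥ 1 and x^0 ≠ x*, because at x^0 = x* it would read 0 < 0 and at k = 0 both sides are equal; for x^0 = x* the non-strict bound is stated instead. *)

theory Defs
  imports "HOL-Analysis.Analysis"
begin

text \<open>
  The components of \<open>\<^bold>f\<close> are indexed by an arbitrary finite linearly ordered type \<open>'m\<close>, which
  stands for \<open>{1, \<dots>, m}\<close> with its usual order; the order matters only for composing projections.
\<close>

definition solution_set :: "(real^'n \<Rightarrow> real^'m) \<Rightarrow> 'm \<Rightarrow> (real^'n) set" where
  "solution_set f i = {x. f x $ i = 0}"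

text \<open>
  As \<open>S\<close> need not be convex, the minimiser need not be unique: a projection is any everywhere
  defined map that selects a minimiser at each point.
\<close>

definition is_projection :: "(real^'n) set \<Rightarrow> (real^'n \<Rightarrow> real^'n) \<Rightarrow> bool" where
  "is_projection S P \<longleftrightarrow> (\<forall>z. is_arg_min (\<lambda>x. (norm (x - z))\<^sup>2) (\<lambda>x. x \<in> S) (P z))"

definition normalized_gradients :: "('m \<Rightarrow> real^'n) \<Rightarrow> real^'m^'n" where
  "normalized_gradients g = (\<chi> r i. (g i /\<^sub>R norm (g i)) $ r)"

definition spectral_norm :: "real^'n^'m \<Rightarrow> real" where
  "spectral_norm A = onorm ((*v) A)"

definition MP :: "('m::finite \<Rightarrow> real^'n \<Rightarrow> real^'n) \<Rightarrow> real^'n \<Rightarrow> real^'n" where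
  "MP P z = (1 / real CARD('m)) *\<^sub>R (\<Sum>i\<in>UNIV. P i z)"

text \<open>\<open>fold\<close> applies the head of the list first, so these are \<open>P\<^sub>m \<circ> \<dots> \<circ> P\<^sub>1\<close> and
  \<open>P (\<sigma> m) \<circ> \<dots> \<circ> P (\<sigma> 1)\<close>.\<close>

definition CP :: "('m::{finite,linorder} \<Rightarrow> real^'n \<Rightarrow> real^'n) \<Rightarrow> real^'n \<Rightarrow> real^'n" where
  "CP P = fold P (sorted_list_of_set UNIV)"

definition RPP :: "('m::{finite,linorder} \<Rightarrow> real^'n \<Rightarrow> real^'n) \<Rightarrow> ('m \<Rightarrow> 'm) \<Rightarrow> real^'n \<Rightarrow> real^'n" where
  "RPP P \<sigma> = fold (\<lambda>j. P (\<sigma> j)) (sorted_list_of_set UNIV)"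

text \<open>The iteration map may depend on the step, as the permutation is drawn afresh in each cycle
  of the randomly permuted method.\<close>

definition generated_by :: "(nat \<Rightarrow> 'a \<Rightarrow> 'a) \<Rightarrow> (nat \<Rightarrow> 'a) \<Rightarrow> bool" where
  "generated_by \<Phi> x \<longleftrightarrow> (\<forall>k. x (Suc k) = \<Phi> k (x k))"

text \<open>
  The strict bound can only be asked for \<open>k \<ge> 1\<close> and \<open>x 0 \<noteq> xs\<close>: both sides agree for \<open>k = 0\<close>, and
  both vanish for \<open>x 0 = xs\<close>, where the first conjunct gives \<open>x k = xs\<close>.
\<close>

definition error_bound :: "real^'n \<Rightarrow> (nat \<Rightarrow> real) \<Rightarrow> (nat \<Rightarrow> real^'n) \<Rightarrow> bool" where
  "error_bound xs q x \<longleftrightarrow> (\<forall>k\<ge>1.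
     norm (x k - xs) \<le> q k * norm (x 0 - xs) \<and>
     (x 0 \<noteq> xs \<longrightarrow> norm (x k - xs) < q k * norm (x 0 - xs)))"

text \<open>\<open>\<epsilon>\<close> ranges over all values for which \<open>\<gamma> = \<epsilon> + spectral_norm (\<nabla>\<Phi>(xs))\<close> is below \<open>1\<close>, so \<open>\<gamma>\<close>
  gets arbitrarily close to the spectral norm at the price of a small \<open>\<delta>\<close>.\<close>

definition locally_linearly_convergent :: "(real^'n \<Rightarrow> real^'n) \<Rightarrow> real^'n \<Rightarrow> bool" where
  "locally_linearly_convergent \<Phi> xs \<longleftrightarrow>
     \<Phi> differentiable (at xs) \<and>
     spectral_norm (jacobian \<Phi> (at xs)) < 1 \<and>
     (\<forall>\<epsilon>>0. \<epsilon> < 1 - spectral_norm (jacobian \<Phi> (at xs)) \<longrightarrow>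
        (let \<gamma> = \<epsilon> + spectral_norm (jacobian \<Phi> (at xs)) in
         0 < \<gamma> \<and> \<gamma> < 1 \<and>
         (\<exists>\<delta>>0. \<forall>x. generated_by (\<lambda>_. \<Phi>) x \<and> x 0 \<in> ball xs \<delta> \<longrightarrow>
            x \<longlonglongrightarrow> xs \<and> error_bound xs (\<lambda>k. \<gamma> ^ k) x)))"

text \<open>
  For a family of iteration maps from which each step draws a member \<open>\<Phi> (\<sigma> k)\<close> with \<open>\<sigma> k \<in> A\<close>,
  the bound is for every realisation \<open>\<sigma>\<close> of the draws, with \<open>\<delta>\<close> independent of the realisation,
  so it holds surely whatever the distribution of the draws. The first error bound accumulates the
  rates of the maps actually drawn (it is \<open>\<gamma>\<^sup>k\<close> if they all have the same rate); the second one
  uses a single rate \<open>\<gamma>\<close> valid for all draws.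
\<close>

definition locally_linearly_convergent_family ::
  "'s set \<Rightarrow> ('s \<Rightarrow> real^'n \<Rightarrow> real^'n) \<Rightarrow> real^'n \<Rightarrow> bool" where
  "locally_linearly_convergent_family A \<Phi> xs \<longleftrightarrow>
     (\<forall>s\<in>A. \<Phi> s differentiable (at xs) \<and> spectral_norm (jacobian (\<Phi> s) (at xs)) < 1) \<and>
     (\<forall>\<epsilon>>0. \<epsilon> < 1 - (MAX s\<in>A. spectral_norm (jacobian (\<Phi> s) (at xs))) \<longrightarrow>
        (let \<gamma> = \<epsilon> + (MAX s\<in>A. spectral_norm (jacobian (\<Phi> s) (at xs))) in
         0 < \<gamma> \<and> \<gamma> < 1 \<and>
         (\<exists>\<delta>>0. \<forall>\<sigma> x. (\<forall>k. \<sigma> k \<in> A) \<and> generated_by (\<lambda>k. \<Phi> (\<sigma> k)) x \<and> x 0 \<in> ball xs \<delta> \<longrightarrow>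
            x \<longlonglongrightarrow> xs \<and>
            error_bound xs (\<lambda>k. \<Prod>j<k. (\<epsilon> + spectral_norm (jacobian (\<Phi> (\<sigma> j)) (at xs)))) x \<and>
            error_bound xs (\<lambda>k. \<gamma> ^ k) x)))"

end

theory Submission
  imports Defs
begin

text \<open>
  Everything rests on the derivatives \<open>D i\<close> of the projections \<open>P i\<close> at \<open>xs\<close>. Since
  \<open>P i \<circ> P i = P i\<close> and \<open>norm (z - P i z) \<le> norm (z - xs)\<close>, the linear map \<open>D i\<close> is idempotent with
  \<open>norm (h - D i h) \<le> norm h\<close>. This forces it to be an orthogonal projection, so it strictly shortens
  every vector that it does not fix (\<open>projection_derivative_paracontracting\<close>). Moreover \<open>f\<^sub>i \<circ> P i = 0\<close>,
  so the range of \<open>D i\<close>, which consists of its fixed vectors, is orthogonal to \<open>g i\<close>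
  (\<open>gradient_orthogonal_projection_derivative\<close>). As \<open>f\<^sub>i\<close> is only assumed differentiable at the point
  \<open>xs\<close>, its zero set may be thinner than a hypersurface and this range may be a proper subspace of the
  hyperplane orthogonal to \<open>g i\<close>; the argument uses the inclusion alone.

  The Jacobians of the iteration maps are compositions of the \<open>D i\<close> (cyclic and permuted projections)
  or their mean (mean projections). Such a combination can preserve the norm of \<open>h\<close> only if each \<open>D i\<close>
  fixes \<open>h\<close> (\<open>fold_paracontracting_fixed\<close>, \<open>sum_paracontracting_fixed\<close>). Then \<open>h\<close> is orthogonal to all
  the gradients, and the rank condition gives \<open>h = 0\<close>. By compactness of the unit sphere the spectral
  norm of the Jacobian is therefore below \<open>1\<close> (\<open>onorm_less_1_if_norm_less\<close>).

  The rest is the local contraction principle, for maps that may change from step to step within a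
  finite family (\<open>locally_linearly_convergent_family_if_derivatives_contract\<close>).
\<close>

section \<open>Paracontracting linear maps\<close>

text \<open>
  The name is from the theory of projection methods; orthogonal projections are the basic example.
\<close>

definition paracontracting :: "('a::real_normed_vector \<Rightarrow> 'a) \<Rightarrow> bool" where
  "paracontracting D \<longleftrightarrow> (\<forall>h. D h \<noteq> h \<longrightarrow> norm (D h) < norm h)"

lemma paracontracting_norm_le: "paracontracting D \<Longrightarrow> norm (D h) \<le> norm h"
  unfolding paracontracting_def by (metis less_imp_le order_refl)

lemma paracontracting_fixed: "paracontracting D \<Longrightarrow> norm h \<le> norm (D h) \<Longrightarrow> D h = h"
  unfolding paracontracting_def by (meson not_le)

lemma fold_paracontracting_norm_le:
  fixes D :: "'i \<Rightarrow> 'a::real_normed_vector \<Rightarrow> 'a"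
  assumes "\<And>i. paracontracting (D i)"
  shows "norm (fold D l h) \<le> norm h"
proof (induction l arbitrary: h)
  case (Cons i l)
  show ?case using Cons[of "D i h"] paracontracting_norm_le[OF assms, of i h] by simp
qed simp

text \<open>
  No factor of a composition can increase the norm, so if the composition preserves it, then the
  first factor applied preserves it and fixes \<open>h\<close>; hence the second factor is again applied to \<open>h\<close>
  itself, and so on.
\<close>

lemma fold_paracontracting_fixed:
  fixes D :: "'i \<Rightarrow> 'a::real_normed_vector \<Rightarrow> 'a"
  assumes "\<And>i. paracontracting (D i)" and "norm h \<le> norm (fold D l h)" and "i \<in> set l"
  shows "D i h = h"
  using assms(2,3)
proof (induction l)
  case (Cons j l)
  have "norm h \<le> norm (D j h)"
    using fold_paracontracting_norm_le[of D l "D j h"] assms(1) Cons.prems by simp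
  then have "D j h = h" by (rule paracontracting_fixed[OF assms(1)])
  with Cons show ?case by auto
qed simp

text \<open>
  By the triangle inequality the sum has norm at most \<open>card I * norm h\<close>; a single term shorter than
  \<open>h\<close> already makes this strict.
\<close>

lemma sum_paracontracting_fixed:
  assumes "\<And>i. paracontracting (D i)" and "finite I" and "i \<in> I"
    and "real (card I) * norm h \<le> norm (\<Sum>i\<in>I. D i h)"
  shows "D i h = h"
proof (rule ccontr)
  assume "D i h \<noteq> h"
  then have "norm (D i h) < norm h" using assms(1) by (simp add: paracontracting_def)
  then have "(\<Sum>i\<in>I. norm (D i h)) < (\<Sum>i\<in>I. norm h)"
    using assms by (intro sum_strict_mono_ex1) (auto intro: paracontracting_norm_le)
  with assms(4) norm_sum[of "\<lambda>i. D i h" I] show False by simp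
qed

lemma norm_minimal_on_line_imp_orthogonal:
  fixes w r :: "'a::real_inner"
  assumes "\<And>t. norm w \<le> norm (w + t *\<^sub>R r)"
  shows "w \<bullet> r = 0"
proof (cases "r = 0")
  case False
  \<comment> \<open>the parameter at which \<open>w + t r\<close> is shortest\<close>
  define t where "t = - (w \<bullet> r) / (r \<bullet> r)"
  have r: "r \<bullet> r > 0" using False by simp
  have "w \<bullet> w \<le> (w + t *\<^sub>R r) \<bullet> (w + t *\<^sub>R r)"
    using assms[of t] by (simp add: norm_le)
  also have "\<dots> = w \<bullet> w - (w \<bullet> r)\<^sup>2 / (r \<bullet> r)"
    using r by (simp add: t_def inner_add inner_diff inner_commute power2_eq_square field_simps)
  finally show ?thesis using r by (simp add: field_simps)
qed simp

text \<open>
  The hypotheses say that \<open>I - D\<close> is a nonexpansive linear projection, and such a projection is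
  orthogonal: its value on \<open>h\<close>, the vector \<open>w = h - D h\<close>, is also its value on every point
  \<open>w + t D h\<close>, so \<open>w\<close> is the shortest vector of this line. Pythagoras then gives
  \<open>\<parallel>h\<parallel>\<^sup>2 = \<parallel>w\<parallel>\<^sup>2 + \<parallel>D h\<parallel>\<^sup>2\<close>, with \<open>w \<noteq> 0\<close> unless \<open>h\<close> is fixed.
\<close>

lemma idempotent_paracontracting:
  fixes D :: "'a::real_inner \<Rightarrow> 'a"
  assumes "linear D" and idem: "\<And>h. D (D h) = D h"
    and le: "\<And>h. norm (h - D h) \<le> norm h"
  shows "paracontracting D"
  unfolding paracontracting_def
proof (intro allI impI)
  fix h assume "D h \<noteq> h"
  interpret linear D by fact
  define w where "w = h - D h"
  have "norm w \<le> norm (w + t *\<^sub>R D h)" for t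
    using le[of "w + t *\<^sub>R D h"] by (simp add: w_def add diff scaleR idem)
  then have "w \<bullet> D h = 0" by (rule norm_minimal_on_line_imp_orthogonal)
  then have "(norm (w + D h))\<^sup>2 = (norm w)\<^sup>2 + (norm (D h))\<^sup>2"
    by (intro norm_add_Pythagorean) (simp add: orthogonal_def)
  moreover have "w \<noteq> 0" using \<open>D h \<noteq> h\<close> by (simp add: w_def)
  ultimately have "(norm (D h))\<^sup>2 < (norm h)\<^sup>2" by (simp add: w_def)
  then show "norm (D h) < norm h" by (rule power2_less_imp_less) simp
qed

text \<open>
  In finite dimensions the operator norm is attained on the compact unit sphere, so a pointwise
  strict inequality gives a uniform one.
\<close>

lemma onorm_less_1_if_norm_less:
  fixes D :: "'a::euclidean_space \<Rightarrow> 'b::real_normed_vector"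
  assumes D: "bounded_linear D" and less: "\<And>h. h \<noteq> 0 \<Longrightarrow> norm (D h) < norm h"
  shows "onorm D < 1"
proof -
  interpret bounded_linear D by fact
  obtain b :: 'a where "b \<in> Basis" using nonempty_Basis by blast
  then have "sphere (0::'a) 1 \<noteq> {}" by auto
  moreover have "continuous_on (sphere 0 1) (\<lambda>h. norm (D h))"
    by (intro continuous_intros linear_continuous_on D)
  ultimately have "\<exists>s\<in>sphere 0 1. \<forall>u\<in>sphere 0 1. norm (D u) \<le> norm (D s)"
    by (intro continuous_attains_sup compact_sphere)
  then obtain s where s: "norm s = 1" "\<And>u. norm u = 1 \<Longrightarrow> norm (D u) \<le> norm (D s)"
    by auto
  have "onorm D \<le> norm (D s)"
  proof (rule onorm_bound)
    fix h show "norm (D h) \<le> norm (D s) * norm h"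
    proof (cases "h = 0")
      case False
      then have "norm (D (h /\<^sub>R norm h)) \<le> norm (D s)" by (intro s) simp
      with False show ?thesis by (simp add: scaleR field_simps)
    qed (simp add: zero)
  qed simp
  also have "\<dots> < 1" using less[of s] s(1) by force
  finally show ?thesis .
qed

section \<open>Linear convergence to a common fixed point\<close>

lemma spectral_norm_jacobian:
  fixes F :: "real^'n \<Rightarrow> real^'m"
  assumes "(F has_derivative D) (at x)"
  shows "spectral_norm (jacobian F (at x)) = onorm D"
proof -
  have "frechet_derivative F (at x) = D"
    using frechet_derivative_at[OF assms] by simp
  moreover have "linear D" using assms by (rule has_derivative_linear)
  ultimately show ?thesis
    by (simp add: spectral_norm_def jacobian_def matrix_vector_mul(2)[symmetric])
qed

text \<open>
  The factor \<open>\<epsilon> + onorm D\<close> leaves room \<open>\<epsilon>\<close> for the linearisation error. Only half of it is spent on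
  that error, which makes the inequality strict away from the fixed point.
\<close>

lemma has_derivative_fixed_point_bound:
  fixes F :: "'a::real_normed_vector \<Rightarrow> 'a"
  assumes F: "(F has_derivative D) (at x)" and "F x = x" and "\<epsilon> > 0"
  shows "\<exists>\<delta>>0. \<forall>y\<in>ball x \<delta>. y \<noteq> x \<longrightarrow> norm (F y - x) < (\<epsilon> + onorm D) * norm (y - x)"
proof -
  have D: "bounded_linear D" using F by (rule has_derivative_bounded_linear)
  obtain \<delta> where \<delta>: "\<delta> > 0"
    "\<And>y. norm (y - x) < \<delta> \<Longrightarrow> norm (F y - F x - D (y - x)) \<le> (\<epsilon> / 2) * norm (y - x)"
    using F \<open>\<epsilon> > 0\<close> unfolding has_derivative_at_alt by (meson half_gt_zero)
  have "norm (F y - x) < (\<epsilon> + onorm D) * norm (y - x)" if "y \<in> ball x \<delta>" "y \<noteq> x" for y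
  proof -
    have "norm (F y - x) \<le> norm (F y - F x - D (y - x)) + norm (D (y - x))"
      using \<open>F x = x\<close> by (metis diff_add_cancel norm_triangle_ineq)
    also have "\<dots> \<le> (\<epsilon> / 2) * norm (y - x) + onorm D * norm (y - x)"
      using that by (intro add_mono \<delta> onorm D) (simp add: dist_norm norm_minus_commute)
    also have "\<dots> < (\<epsilon> + onorm D) * norm (y - x)"
      using that(2) \<open>\<epsilon> > 0\<close> by (simp add: algebra_simps)
    finally show ?thesis .
  qed
  with \<delta>(1) show ?thesis by blast
qed

lemma error_bound_mono:
  assumes "error_bound xs q x" and "\<And>k. q k \<le> q' k"
  shows "error_bound xs q' x"
proof -
  have "q k * norm (x 0 - xs) \<le> q' k * norm (x 0 - xs)" for k
    using assms(2) by (rule mult_right_mono) simp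
  then show ?thesis
    using assms(1) unfolding error_bound_def by (meson order.trans order.strict_trans2)
qed

text \<open>
  As no step expands, the iterates never leave the ball, so the contraction estimate applies at
  every step. The first step already gives a strict inequality when \<open>x 0 \<noteq> xs\<close>. Later iterates may
  hit \<open>xs\<close> exactly, and then a step contributes only \<open>\<le>\<close>; strictness survives because the factors
  \<open>q k\<close> are positive.
\<close>

lemma error_bound_prod:
  assumes gen: "generated_by \<Phi> x" and x0: "x 0 \<in> ball xs \<delta>"
    and q: "\<And>k. 0 < q k" "\<And>k. q k \<le> 1"
    and fixed: "\<And>k. \<Phi> k xs = xs"
    and less: "\<And>k y. y \<in> ball xs \<delta> \<Longrightarrow> y \<noteq> xs \<Longrightarrow> norm (\<Phi> k y - xs) < q k * norm (y - xs)"
  shows "error_bound xs (\<lambda>k. \<Prod>j<k. q j) x"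
proof -
  have step: "norm (x (Suc k) - xs) \<le> q k * norm (x k - xs)" if "x k \<in> ball xs \<delta>" for k
    using less[OF that, of k] gen fixed[of k] by (cases "x k = xs") (auto simp: generated_by_def)
  have ball: "x k \<in> ball xs \<delta>" for k
  proof (induction k)
    case (Suc k)
    have "norm (x (Suc k) - xs) \<le> 1 * norm (x k - xs)"
      using step[OF Suc] mult_right_mono[OF q(2), of "norm (x k - xs)" k] by simp
    with Suc show ?case by (simp add: dist_norm norm_minus_commute)
  qed (rule x0)
  have "norm (x (Suc k) - xs) \<le> (\<Prod>j<Suc k. q j) * norm (x 0 - xs) \<and>
     (x 0 \<noteq> xs \<longrightarrow> norm (x (Suc k) - xs) < (\<Prod>j<Suc k. q j) * norm (x 0 - xs))" for k
  proof (induction k)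
    case 0
    show ?case using step[OF x0] less[OF x0] gen by (simp add: generated_by_def)
  next
    case (Suc k)
    define b where "b = (\<Prod>j<Suc k. q j) * norm (x 0 - xs)"
    have b_next: "(\<Prod>j<Suc (Suc k). q j) * norm (x 0 - xs) = q (Suc k) * b"
      by (simp add: b_def)
    have "q (Suc k) * norm (x (Suc k) - xs) \<le> q (Suc k) * b"
      "x 0 \<noteq> xs \<Longrightarrow> q (Suc k) * norm (x (Suc k) - xs) < q (Suc k) * b"
      using Suc q(1)[of "Suc k"] unfolding b_def by simp_all
    with step[OF ball, of "Suc k"] show ?case
      unfolding b_next by (meson order.trans order.strict_trans1)
  qed
  then show ?thesis unfolding error_bound_def by (auto dest!: Suc_le_D simp del: prod.lessThan_Suc)
qed

lemma error_bound_power_imp_tendsto: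
  assumes "error_bound xs (\<lambda>k. \<gamma> ^ k) x" and "0 \<le> \<gamma>" "\<gamma> < 1"
  shows "x \<longlonglongrightarrow> xs"
proof (rule Lim_null_comparison[THEN LIM_zero_cancel])
  show "\<forall>\<^sub>F k in sequentially. norm (x k - xs) \<le> \<gamma> ^ k * norm (x 0 - xs)"
    using assms(1) unfolding error_bound_def eventually_sequentially by blast
  show "(\<lambda>k. \<gamma> ^ k * norm (x 0 - xs)) \<longlonglongrightarrow> 0"
    using assms by (intro tendsto_mult_left_zero LIMSEQ_power_zero) simp
qed

text \<open>
  A radius that works for every choice of maps exists because the family is finite: each map comes
  with its own radius, and the smallest of them serves all.
\<close>

lemma locally_linearly_convergent_family_if_derivatives_contract:
  fixes \<Phi> :: "'s \<Rightarrow> real^'n \<Rightarrow> real^'n"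
  assumes A: "finite A" "A \<noteq> {}"
    and der: "\<And>s. s \<in> A \<Longrightarrow> (\<Phi> s has_derivative D s) (at xs)"
    and fixed: "\<And>s. s \<in> A \<Longrightarrow> \<Phi> s xs = xs"
    and less: "\<And>s h. s \<in> A \<Longrightarrow> h \<noteq> 0 \<Longrightarrow> norm (D s h) < norm h"
  shows "locally_linearly_convergent_family A \<Phi> xs"
proof -
  define r where "r s = spectral_norm (jacobian (\<Phi> s) (at xs))" for s
  define M where "M = (MAX s\<in>A. r s)"
  have D: "bounded_linear (D s)" if "s \<in> A" for s
    using der[OF that] by (rule has_derivative_bounded_linear)
  have r: "r s = onorm (D s)" if "s \<in> A" for s
    using der[OF that] by (simp add: r_def spectral_norm_jacobian)
  have r_bounds: "0 \<le> r s" "r s < 1" if "s \<in> A" for s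
    using that A r[OF that] onorm_pos_le[OF D[OF that]]
      onorm_less_1_if_norm_less[OF D[OF that] less[OF that]]
    by simp_all
  have r_le: "r s \<le> M" if "s \<in> A" for s
    unfolding M_def using that A by (intro Max_ge) auto
  have "0 \<le> M" using A r_bounds(1) r_le by (meson all_not_in_conv order.trans)
  have "\<exists>\<delta>>0. \<forall>\<sigma> x. (\<forall>k. \<sigma> k \<in> A) \<and> generated_by (\<lambda>k. \<Phi> (\<sigma> k)) x \<and> x 0 \<in> ball xs \<delta> \<longrightarrow>
            x \<longlonglongrightarrow> xs \<and> error_bound xs (\<lambda>k. \<Prod>j<k. (\<epsilon> + r (\<sigma> j))) x \<and>
            error_bound xs (\<lambda>k. (\<epsilon> + M) ^ k) x"
    if \<epsilon>: "\<epsilon> > 0" "\<epsilon> < 1 - M" for \<epsilon>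
  proof -
    have "\<forall>s\<in>A. \<exists>\<delta>>0. \<forall>y\<in>ball xs \<delta>. y \<noteq> xs \<longrightarrow> norm (\<Phi> s y - xs) < (\<epsilon> + r s) * norm (y - xs)"
      using has_derivative_fixed_point_bound[OF der fixed \<epsilon>(1)] r by simp
    then obtain d where d: "\<And>s. s \<in> A \<Longrightarrow> d s > 0"
      "\<And>s y. s \<in> A \<Longrightarrow> y \<in> ball xs (d s) \<Longrightarrow> y \<noteq> xs \<Longrightarrow>
         norm (\<Phi> s y - xs) < (\<epsilon> + r s) * norm (y - xs)"
      by metis
    define \<delta> where "\<delta> = (MIN s\<in>A. d s)"
    have "\<delta> > 0" using A d(1) by (simp add: \<delta>_def)
    have \<delta>_le: "\<delta> \<le> d s" if "s \<in> A" for s using A that by (simp add: \<delta>_def)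
    have "x \<longlonglongrightarrow> xs \<and> error_bound xs (\<lambda>k. \<Prod>j<k. (\<epsilon> + r (\<sigma> j))) x \<and>
        error_bound xs (\<lambda>k. (\<epsilon> + M) ^ k) x"
      if \<sigma>: "\<forall>k. \<sigma> k \<in> A" and x: "generated_by (\<lambda>k. \<Phi> (\<sigma> k)) x" "x 0 \<in> ball xs \<delta>" for \<sigma> x
    proof -
      have q: "0 < \<epsilon> + r (\<sigma> k)" "\<epsilon> + r (\<sigma> k) \<le> \<epsilon> + M" for k
        using r_bounds[of "\<sigma> k"] r_le[of "\<sigma> k"] \<sigma> \<epsilon>(1) by (simp_all add: add_pos_nonneg)
      have *: "error_bound xs (\<lambda>k. \<Prod>j<k. (\<epsilon> + r (\<sigma> j))) x"
      proof (rule error_bound_prod[OF x q(1)])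
        show "\<epsilon> + r (\<sigma> k) \<le> 1" for k using q(2)[of k] \<epsilon>(2) by simp
        show "\<Phi> (\<sigma> k) xs = xs" for k using \<sigma> fixed by blast
        show "norm (\<Phi> (\<sigma> k) y - xs) < (\<epsilon> + r (\<sigma> k)) * norm (y - xs)"
          if "y \<in> ball xs \<delta>" "y \<noteq> xs" for k y
          using d(2)[of "\<sigma> k" y] \<delta>_le[of "\<sigma> k"] \<sigma> that by simp
      qed
      have "(\<Prod>j<k. (\<epsilon> + r (\<sigma> j))) \<le> (\<Prod>j<k. \<epsilon> + M)" for k
        using q by (intro prod_mono) (auto intro: less_imp_le)
      then have **: "error_bound xs (\<lambda>k. (\<epsilon> + M) ^ k) x"
        by (intro error_bound_mono[OF *]) simp
      moreover have "x \<longlonglongrightarrow> xs"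
        using ** \<epsilon> \<open>0 \<le> M\<close> by (intro error_bound_power_imp_tendsto[of xs "\<epsilon> + M" x]) auto
      ultimately show ?thesis using * by blast
    qed
    with \<open>\<delta> > 0\<close> show ?thesis by blast
  qed
  moreover have "0 < \<epsilon> + M" "\<epsilon> + M < 1" if "\<epsilon> > 0" "\<epsilon> < 1 - M" for \<epsilon>
    using that \<open>0 \<le> M\<close> by linarith+
  moreover have "\<Phi> s differentiable (at xs)" if "s \<in> A" for s
    using der[OF that] by (rule differentiableI)
  ultimately show ?thesis
    unfolding locally_linearly_convergent_family_def Let_def r_def[symmetric] M_def[symmetric]
    using r_bounds(2) by blast
qed

text \<open>
  A single iteration map is a family with one member, so all three methods reduce to the preceding
  result about families.
\<close>

lemma locally_linearly_convergent_iff_family: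
  "locally_linearly_convergent \<Phi> xs \<longleftrightarrow> locally_linearly_convergent_family {()} (\<lambda>_. \<Phi>) xs"
  by (simp add: locally_linearly_convergent_def locally_linearly_convergent_family_def Let_def)

lemma fold_fixed_point: "(\<And>i. P i x = x) \<Longrightarrow> fold P l x = x"
  by (induction l) simp_all

text \<open>
  All maps fix \<open>x\<close>, so every derivative in the chain rule is taken at \<open>x\<close>.
\<close>

lemma has_derivative_fold_at_fixed_point:
  assumes "\<And>i. (P i has_derivative D i) (at x)" and "\<And>i. P i x = x"
  shows "(fold P l has_derivative fold D l) (at x)"
proof (induction l)
  case (Cons i l)
  then show ?case
    using diff_chain_at[OF assms(1)[of i], of "fold P l" "fold D l"] assms(2) by (simp add: comp_def)
qed (simp add: id_def)

section \<open>Derivatives of projections\<close>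

lemma is_projection_in: "is_projection S P \<Longrightarrow> P z \<in> S"
  by (simp add: is_projection_def is_arg_min_def)

lemma is_projection_norm_le: "is_projection S P \<Longrightarrow> y \<in> S \<Longrightarrow> norm (P z - z) \<le> norm (y - z)"
  unfolding is_projection_def is_arg_min_linorder by (meson norm_ge_zero power2_le_imp_le)

lemma is_projection_fixed: "is_projection S P \<Longrightarrow> y \<in> S \<Longrightarrow> P y = y"
  using is_projection_norm_le[of S P y y] by simp

text \<open>
  Near \<open>x\<close> the map \<open>F\<close> agrees with \<open>F'\<close> up to an arbitrarily small multiple of the distance, so a
  bound on \<open>F\<close> along the ray \<open>x + t h\<close> passes to \<open>F' (t h)\<close>; homogeneity removes \<open>t\<close>.
\<close>

lemma has_derivative_norm_le:
  fixes F F' :: "'a::real_normed_vector \<Rightarrow> 'b::real_normed_vector"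
  assumes F: "(F has_derivative F') (at x)" and "F x = 0"
    and le: "\<And>z. norm (F z) \<le> norm (z - x)"
  shows "norm (F' h) \<le> norm h"
proof (cases "h = 0")
  case True
  with F show ?thesis by (simp add: linear_0 has_derivative_linear)
next
  case False
  interpret F': bounded_linear F' using F by (rule has_derivative_bounded_linear)
  show ?thesis
  proof (rule field_le_epsilon)
    fix e :: real assume "e > 0"
    define e' where "e' = e / norm h"
    have "e' > 0" using \<open>e > 0\<close> False by (simp add: e'_def)
    then obtain d where d: "d > 0"
      "\<And>y. norm (y - x) < d \<Longrightarrow> norm (F y - F x - F' (y - x)) \<le> e' * norm (y - x)"
      using F unfolding has_derivative_at_alt by blast
    define t where "t = d / (2 * norm h)"
    have t: "t > 0" "norm (t *\<^sub>R h) < d" using False d by (auto simp: t_def)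
    have "norm (F (x + t *\<^sub>R h) - F' (t *\<^sub>R h)) \<le> e' * norm (t *\<^sub>R h)"
      using d(2)[of "x + t *\<^sub>R h"] t \<open>F x = 0\<close> by simp
    moreover have "norm (F (x + t *\<^sub>R h)) \<le> norm (t *\<^sub>R h)"
      using le[of "x + t *\<^sub>R h"] by simp
    ultimately have "norm (F' (t *\<^sub>R h)) \<le> norm (t *\<^sub>R h) + e' * norm (t *\<^sub>R h)"
      using norm_triangle_sub[of "F' (t *\<^sub>R h)" "F (x + t *\<^sub>R h)"] by (simp add: norm_minus_commute)
    then have "t * norm (F' h) \<le> t * (norm h + e' * norm h)"
      using t by (simp add: F'.scaleR algebra_simps)
    then show "norm (F' h) \<le> norm h + e"
      using t False by (simp add: e'_def)
  qed
qed

text \<open>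
  Two properties of \<open>P\<close> are inherited by its derivative. Points of \<open>S\<close> are their own projections, so
  \<open>P \<circ> P = P\<close>, and the chain rule at the fixed point \<open>xs\<close> gives \<open>D \<circ> D = D\<close>. Since \<open>xs\<close> is itself a
  candidate for the minimiser, \<open>z - P z\<close> is no longer than \<open>z - xs\<close>, so \<open>norm (h - D h) \<le> norm h\<close>.
\<close>

lemma projection_derivative_paracontracting:
  assumes P: "is_projection S P" and "xs \<in> S" and D: "(P has_derivative D) (at xs)"
  shows "paracontracting D"
proof (rule idempotent_paracontracting)
  show "linear D" using D by (rule has_derivative_linear)
  have fixed: "P xs = xs" using P \<open>xs \<in> S\<close> by (rule is_projection_fixed)
  have "P \<circ> P = P" using is_projection_fixed[OF P is_projection_in[OF P]] by auto
  moreover have "(P \<circ> P has_derivative D \<circ> D) (at xs)"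
    using D fixed by (intro diff_chain_at) simp_all
  ultimately have "D \<circ> D = D" using D by (metis has_derivative_unique)
  then show "D (D h) = D h" for h by (metis comp_apply)
  show "norm (h - D h) \<le> norm h" for h
  proof (rule has_derivative_norm_le)
    show "((\<lambda>z. z - P z) has_derivative (\<lambda>h. h - D h)) (at xs)"
      by (intro derivative_intros D)
    show "norm (z - P z) \<le> norm (z - xs)" for z
      using is_projection_norm_le[OF P \<open>xs \<in> S\<close>, of z] by (simp add: norm_minus_commute)
  qed (simp add: fixed)
qed

text \<open>
  The values of \<open>P\<close> are zeros of \<open>\<phi>\<close>, so \<open>\<phi> \<circ> P\<close> vanishes identically, and so does its derivative
  \<open>h \<mapsto> g \<bullet> D h\<close>.
\<close>

lemma gradient_orthogonal_projection_derivative: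
  assumes "GDERIV \<phi> xs :> g" and "(P has_derivative D) (at xs)" and "P xs = xs"
    and "\<And>z. \<phi> (P z) = 0"
  shows "g \<bullet> D h = 0"
proof -
  have "(\<phi> \<circ> P has_derivative (\<lambda>h. h \<bullet> g) \<circ> D) (at xs)"
    using assms by (intro diff_chain_at) (simp_all add: gderiv_def)
  moreover have "(\<phi> \<circ> P has_derivative (\<lambda>h. 0)) (at xs)"
    using assms(4) by (simp add: comp_def)
  ultimately have "(\<lambda>h. h \<bullet> g) \<circ> D = (\<lambda>h. 0)" by (rule has_derivative_unique)
  then show ?thesis by (metis comp_apply inner_commute)
qed

text \<open>
  Full row rank of the matrix with columns \<open>g i / norm (g i)\<close> is injectivity of its transpose, which
  maps \<open>h\<close> to the vector of its inner products with these columns.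
\<close>

lemma rank_normalized_gradients_full_imp:
  fixes g :: "'m::finite \<Rightarrow> real^'n"
  assumes "rank (normalized_gradients g) = CARD('n)" and "\<And>i. g i \<bullet> h = 0"
  shows "h = 0"
proof -
  have "inj ((*v) (transpose (normalized_gradients g)))"
    using assms(1) by (simp add: full_rank_injective[symmetric] rank_transpose)
  moreover have "transpose (normalized_gradients g) *v h = 0"
  proof (rule vec_eq_iff[THEN iffD2, rule_format])
    fix i
    have "(transpose (normalized_gradients g) *v h) $ i = (g i /\<^sub>R norm (g i)) \<bullet> h"
      by (simp add: matrix_vector_mult_def transpose_def normalized_gradients_def inner_vec_def)
    then show "(transpose (normalized_gradients g) *v h) $ i = 0 $ i" using assms(2) by simp
  qed
  ultimately show ?thesis by (metis injD matrix_vector_mult_0_right)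
qed

section \<open>Convergence of the projection methods\<close>

theorem theorem4p1:
  fixes f :: "real^'n \<Rightarrow> real^'m::{finite,linorder}"
    and xs :: "real^'n"
    and g :: "'m \<Rightarrow> real^'n"
    and P :: "'m \<Rightarrow> real^'n \<Rightarrow> real^'n"
  assumes "f xs = 0"
    and "\<And>i. GDERIV (\<lambda>x. f x $ i) xs :> g i"
    and "\<And>i. g i \<noteq> 0"
    and "\<And>i. is_projection (solution_set f i) (P i)"
    and "\<And>i. P i differentiable (at xs)"
    and "rank (normalized_gradients g) = CARD('n)"
  shows "locally_linearly_convergent (MP P) xs \<and>
    locally_linearly_convergent (CP P) xs \<and>
    locally_linearly_convergent_family {\<sigma>. \<sigma> permutes UNIV} (RPP P) xs"
proof -
  have xs: "xs \<in> solution_set f i" for i using assms(1) by (simp add: solution_set_def)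
  have fixed: "P i xs = xs" for i using assms(4) xs by (rule is_projection_fixed)
  define D where "D i = frechet_derivative (P i) (at xs)" for i
  have D: "(P i has_derivative D i) (at xs)" for i
    using assms(5) unfolding D_def frechet_derivative_works .
  have para: "paracontracting (D i)" for i
    using assms(4) xs D by (rule projection_derivative_paracontracting)
  have orth: "g i \<bullet> D i h = 0" for i h
    using is_projection_in[OF assms(4)]
    by (intro gradient_orthogonal_projection_derivative[OF assms(2) D fixed])
      (simp add: solution_set_def)
  have common: "h = 0" if "\<And>i. D i h = h" for h
    using orth[of _ h] that by (intro rank_normalized_gradients_full_imp[OF assms(6)]) simp
  \<comment> \<open>Surjectivity of \<open>\<sigma>\<close> makes every projection occur in the cycle, so that every gradient counts;
    the identity gives the cyclic method.\<close>
  have fold_less: "norm (fold (\<lambda>j. D (\<sigma> j)) (sorted_list_of_set UNIV) h) < norm h"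
    if "surj \<sigma>" "h \<noteq> 0" for \<sigma> :: "'m \<Rightarrow> 'm" and h
  proof (rule ccontr)
    assume "\<not> ?thesis"
    then have "D (\<sigma> j) h = h" for j
      using fold_paracontracting_fixed[of "\<lambda>j. D (\<sigma> j)" h "sorted_list_of_set UNIV" j] para by simp
    with common \<open>surj \<sigma>\<close> \<open>h \<noteq> 0\<close> show False by (metis surjD)
  qed
  have RPP: "locally_linearly_convergent_family {\<sigma>. \<sigma> permutes UNIV} (RPP P) xs"
  proof (rule locally_linearly_convergent_family_if_derivatives_contract)
    show "finite {\<sigma>::'m \<Rightarrow> 'm. \<sigma> permutes UNIV}" by (simp add: finite_permutations)
    show "{\<sigma>::'m \<Rightarrow> 'm. \<sigma> permutes UNIV} \<noteq> {}" using permutes_id by blast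
    fix \<sigma> :: "'m \<Rightarrow> 'm" assume "\<sigma> \<in> {\<sigma>. \<sigma> permutes UNIV}"
    then have "surj \<sigma>" by (simp add: permutes_surj)
    show "(RPP P \<sigma> has_derivative fold (\<lambda>j. D (\<sigma> j)) (sorted_list_of_set UNIV)) (at xs)"
      unfolding RPP_def by (intro has_derivative_fold_at_fixed_point D fixed)
    show "RPP P \<sigma> xs = xs" unfolding RPP_def by (intro fold_fixed_point fixed)
    show "norm (fold (\<lambda>j. D (\<sigma> j)) (sorted_list_of_set UNIV) h) < norm h" if "h \<noteq> 0" for h
      using \<open>surj \<sigma>\<close> that by (rule fold_less)
  qed
  have CP: "locally_linearly_convergent (CP P) xs"
    unfolding locally_linearly_convergent_iff_family
  proof (rule locally_linearly_convergent_family_if_derivatives_contract)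
    show "(CP P has_derivative fold D (sorted_list_of_set UNIV)) (at xs)"
      unfolding CP_def by (intro has_derivative_fold_at_fixed_point D fixed)
    show "CP P xs = xs" unfolding CP_def by (intro fold_fixed_point fixed)
    show "norm (fold D (sorted_list_of_set UNIV) h) < norm h" if "h \<noteq> 0" for h
      using fold_less[of "\<lambda>j. j"] that by simp
  qed simp_all
  have MP: "locally_linearly_convergent (MP P) xs"
    unfolding locally_linearly_convergent_iff_family
  proof (rule locally_linearly_convergent_family_if_derivatives_contract)
    show "(MP P has_derivative (\<lambda>h. (1 / real CARD('m)) *\<^sub>R (\<Sum>i\<in>UNIV. D i h))) (at xs)"
      unfolding MP_def by (intro derivative_intros D)
    show "MP P xs = xs" by (simp add: MP_def fixed sum_constant_scaleR del: sum_constant)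
    show "norm ((1 / real CARD('m)) *\<^sub>R (\<Sum>i\<in>UNIV. D i h)) < norm h" if "h \<noteq> 0" for h
    proof (rule ccontr)
      assume "\<not> ?thesis"
      then have "real CARD('m) * norm h \<le> norm (\<Sum>i\<in>UNIV. D i h)" by (simp add: field_simps)
      then have "D i h = h" for i using sum_paracontracting_fixed[of D UNIV i h] para by simp
      with common that show False by blast
    qed
  qed simp_all
  show ?thesis using MP CP RPP by blast
qed

end
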